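(* For any positive integer $n$ with $n \ge 4$, the congruence $$n^x\equiv (n+1)^y+(n+2)^z+(n+3)^w \pmod{12(n+1)(n+2)}$$ does not hold for any positive integers $x,y,z$ and $w$. *)

theory Defs
  imports "HOL-Number_Theory.Cong"
begin

end

theory Submission
  imports Defs
begin

text \<open>
  Reducing the congruence modulo \<open>n + 1\<close> and \<open>n + 2\<close> leaves only powers of \<open>2\<close> and signs:
  \<open>(-1)^x \<equiv> 1 + 2^w\<close> modulo \<open>n + 1\<close> and \<open>(-2)^x \<equiv> (-1)^y + 1\<close> modulo \<open>n + 2\<close>.
  The parities of \<open>x\<close> and \<open>y\<close> decide what these say.

  If \<open>x\<close> is even, then \<open>n + 1\<close> divides \<open>2^w\<close>, so \<open>n + 1 = 2^k\<close>. As \<open>n + 2 = 2^k + 1\<close> is odd,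
  it does not divide \<open>2^x\<close>; hence \<open>y\<close> is even and \<open>n + 2\<close> divides \<open>2^(x-1) - 1\<close>.
  But the order of \<open>2\<close> modulo \<open>2^k + 1\<close> is the even number \<open>2k\<close>
  (\<open>two_power_cong_1_mod_Fermat_like_imp_even\<close>), so \<open>x\<close> would be odd.

  If \<open>x\<close> and \<open>y\<close> are odd, then \<open>n + 2\<close> divides \<open>2^x\<close>, so \<open>n + 2 = 2^k\<close>, and the Mersenne number
  \<open>n + 1 = 2^k - 1\<close> divides \<open>2^(w-1) + 1\<close>. This is impossible, because the powers of \<open>2\<close> modulo
  \<open>2^k - 1\<close> are just \<open>1, 2, ..., 2^(k-1)\<close> (\<open>Mersenne_not_dvd_two_power_plus_1\<close>).

  If \<open>x\<close> is odd and \<open>y\<close> is even, then \<open>n + 2\<close> divides \<open>2 (a^2 + 1)\<close> with \<open>a = 2^((x-1)/2)\<close>.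
  Odd divisors of a number \<open>a^2 + 1\<close> are \<open>1\<close> modulo \<open>4\<close> (\<open>odd_dvd_square_plus_1_imp_mod_4_eq_1\<close>).
  Hence \<open>n + 2\<close> is \<open>1\<close> modulo \<open>4\<close> or \<open>2\<close> modulo \<open>8\<close>, and not divisible by \<open>3\<close>. The first option
  is excluded since \<open>n + 1\<close> divides \<open>2 (2^(w-1) + 1)\<close>, which is not a multiple of \<open>4\<close>; so
  \<open>n \<equiv> 0\<close> modulo \<open>8\<close> and \<open>n\<close> is not \<open>1\<close> modulo \<open>3\<close>.
  Now \<open>0 \<equiv> 1 + 2^z + 3^w\<close> modulo \<open>8\<close> gives \<open>z = 2\<close> and \<open>w\<close> odd, whereas modulo \<open>3\<close> the
  congruence makes \<open>z\<close> odd (if \<open>n \<equiv> 0\<close>) or \<open>w\<close> even (if \<open>n \<equiv> 2\<close>).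
\<close>

section \<open>Odd divisors of \<open>a\<^sup>2 + 1\<close>\<close>

text \<open>
  A descent replaces a factorisation into primes: choose an even representative \<open>r < m\<close> of \<open>\<plusminus>a\<close>
  modulo \<open>m\<close>. Then \<open>r^2 + 1 = m c\<close> is \<open>1\<close> modulo \<open>4\<close>, and the cofactor \<open>c < m\<close> is
  \<open>1\<close> modulo \<open>4\<close> by induction.
\<close>

lemma odd_dvd_square_plus_1_imp_mod_4_eq_1:
  fixes m a :: int
  assumes "m > 0" "odd m" "m dvd a ^ 2 + 1"
  shows "m mod 4 = 1"
  using assms
proof (induction "nat m" arbitrary: m a rule: less_induct)
  case less
  show ?case
  proof (cases "m = 1")
    case True
    then show ?thesis by simp
  next
    case False
    define r where "r = (if even (a mod m) then a mod m else m - a mod m)"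
    have r: "even r" "0 \<le> r" "r < m"
    proof -
      have "0 \<le> a mod m" "a mod m < m"
        using less.prems(1) by simp_all
      moreover have "a mod m \<noteq> 0" if "odd (a mod m)"
        using that by (intro notI) simp
      ultimately show "even r" "0 \<le> r" "r < m"
        using less.prems(2) unfolding r_def by (auto split: if_splits)
    qed
    have "[r ^ 2 = a ^ 2] (mod m)"
    proof (cases "even (a mod m)")
      case True
      then show ?thesis by (simp add: r_def cong_def power_mod)
    next
      case False
      have "[m - a mod m = - a] (mod m)"
        by (simp add: cong_def mod_simps)
      then have "[(m - a mod m) ^ 2 = (- a) ^ 2] (mod m)"
        by (rule cong_pow)
      then show ?thesis using False by (simp add: r_def)
    qed
    then have "[r ^ 2 + 1 = a ^ 2 + 1] (mod m)"
      by (simp add: cong_add_rcancel)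
    then have "m dvd r ^ 2 + 1"
      using less.prems(3) cong_dvd_iff by blast
    then obtain c where c: "r ^ 2 + 1 = m * c" ..
    have "r ^ 2 \<le> (m - 1) ^ 2"
      using r by (intro power_mono) auto
    then have "m * c < m * m"
    proof -
      have "(m - 1) ^ 2 = m * m - 2 * m + 1"
        by (simp add: power2_eq_square algebra_simps)
      then show ?thesis
        using \<open>r ^ 2 \<le> (m - 1) ^ 2\<close> c less.prems(1) False by linarith
    qed
    then have "c < m"
      using less.prems(1) by simp
    have "0 < m * c"
      by (simp flip: c add: add_nonneg_pos)
    then have "c > 0"
      using less.prems(1) by (simp add: zero_less_mult_iff)
    have "odd (m * c)"
      using r(1) by (simp flip: c)
    then have "odd c"
      by simp
    have "c mod 4 = 1"
    proof (rule less.hyps)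
      show "nat c < nat m" using \<open>c < m\<close> \<open>c > 0\<close> by simp
      show "c dvd r ^ 2 + 1" using c by simp
    qed fact+
    obtain s where "r = 2 * s" using r(1) by blast
    then have "(m * c) mod 4 = 1"
      by (simp flip: c add: power_mult_distrib)
    then show ?thesis
      using \<open>c mod 4 = 1\<close> by (metis mod_mult_right_eq mult.right_neutral)
  qed
qed

section \<open>Powers of \<open>2\<close> and \<open>3\<close> in congruences and divisibilities\<close>

text \<open>
  Since \<open>2^k \<equiv> -1\<close>, the exponent \<open>e\<close> may be reduced modulo \<open>2 k\<close> without changing its parity.
  The remainder is then \<open>0\<close>: a remainder \<open>k + s\<close> would give the power \<open>-(2^s)\<close> with \<open>s < k\<close>, and
  neither this nor \<open>2^r\<close> with \<open>0 < r < k\<close> differs from \<open>1\<close> by a multiple of \<open>2^k + 1\<close>, the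
  differences being nonzero and too small.
\<close>

lemma two_power_cong_1_mod_Fermat_like_imp_even:
  fixes e k :: nat
  assumes "k > 0" "[2 ^ e = 1] (mod (2 ^ k + 1 :: int))"
  shows "even e"
proof -
  let ?m = "2 ^ k + 1 :: int"
  define r where "r = e mod (2 * k)"
  have minus: "[2 ^ k = - 1] (mod ?m)"
    by (simp add: cong_iff_dvd_diff)
  have "[(2 ^ k) ^ 2 = (- 1) ^ 2] (mod ?m)"
    using minus by (rule cong_pow)
  then have "[2 ^ (2 * k) = 1] (mod ?m)"
    by (simp add: mult.commute flip: power_mult)
  then have "[(2 ^ (2 * k)) ^ (e div (2 * k)) * 2 ^ r = 1 ^ (e div (2 * k)) * 2 ^ r] (mod ?m)"
    by (intro cong_mult cong_pow) auto
  then have "[2 ^ e = 2 ^ r] (mod ?m)"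
    by (simp add: r_def flip: power_mult power_add)
  then have r: "[2 ^ r = 1] (mod ?m)"
    using assms(2) cong_sym cong_trans by blast
  have "r < 2 * k"
    using assms(1) by (simp add: r_def)
  have "r < k"
  proof (rule ccontr)
    assume "\<not> r < k"
    then obtain s where s: "r = k + s"
      using le_Suc_ex not_less by blast
    have "[2 ^ k * 2 ^ s = - 1 * 2 ^ s] (mod ?m)"
      using minus by (intro cong_mult) auto
    then have "[- (2 ^ s) = 1] (mod ?m)"
      using r s by (simp add: power_add) (meson cong_sym cong_trans)
    then have "?m dvd - (2 ^ s) - 1"
      by (simp add: cong_iff_dvd_diff)
    then have "?m dvd 2 ^ s + 1"
      by (metis dvd_minus_iff minus_add_distrib uminus_add_conv_diff add.commute)
    then have "(2::int) ^ k \<le> 2 ^ s"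
      by (auto dest: zdvd_imp_le)
    then show False
      using \<open>r < 2 * k\<close> s by simp
  qed
  have "?m dvd 2 ^ r - 1"
    using r by (simp add: cong_iff_dvd_diff)
  moreover have "(2::int) ^ r < 2 ^ k"
    using \<open>r < k\<close> by simp
  ultimately have "(2::int) ^ r = 1"
    using zdvd_imp_le[of ?m "2 ^ r - 1"] by (smt (verit) one_le_power)
  then have "r = 0"
    by simp
  then show ?thesis
    by (simp add: r_def) (metis dvd_eq_mod_eq_0 dvd_mult_left)
qed

text \<open>
  Since \<open>2^k \<equiv> 1\<close>, one may assume \<open>e < k\<close>, and then \<open>2^e + 1\<close> is positive and less than
  \<open>2^k - 1\<close>. The bound \<open>3 \<le> k\<close> excludes the divisibilities of \<open>2 + 1\<close> by \<open>2^2 - 1\<close> and of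
  \<open>1 + 1\<close> by \<open>2^1 - 1\<close>.
\<close>

lemma Mersenne_not_dvd_two_power_plus_1:
  fixes e k :: nat
  assumes "k \<ge> 3"
  shows "\<not> (2 ^ k - 1 :: int) dvd 2 ^ e + 1"
proof
  let ?m = "2 ^ k - 1 :: int"
  assume dvd: "?m dvd 2 ^ e + 1"
  define r where "r = e mod k"
  have "[2 ^ k = 1] (mod ?m)"
    by (simp add: cong_iff_dvd_diff)
  then have "[(2 ^ k) ^ (e div k) * 2 ^ r + 1 = 1 ^ (e div k) * 2 ^ r + 1] (mod ?m)"
    by (intro cong_mult cong_pow cong_add) auto
  then have "[2 ^ e + 1 = 2 ^ r + 1] (mod ?m)"
    by (simp add: r_def flip: power_mult power_add)
  then have "?m dvd 2 ^ r + 1"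
    using dvd cong_dvd_iff by blast
  then have "?m \<le> 2 ^ r + 1"
    by (rule zdvd_imp_le) (simp add: add_nonneg_pos)
  moreover have "(2::int) ^ r \<le> 2 ^ (k - 1)"
    using assms by (intro power_increasing) (auto simp: r_def less_Suc_eq_le[symmetric])
  moreover have "(2::int) ^ k = 2 * 2 ^ (k - 1)"
    using assms by (simp flip: power_Suc)
  moreover have "(2::int) ^ 2 \<le> 2 ^ (k - 1)"
    using assms by (intro power_increasing) auto
  moreover have "(2::int) ^ 2 = 4"
    by simp
  ultimately show False
    by linarith
qed

lemma int_dvd_two_power_imp_power:
  fixes m :: int
  assumes "m > 0" "m dvd 2 ^ e"
  obtains k where "m = 2 ^ k"
proof -
  have "nat m dvd 2 ^ e"
    using assms by (simp add: nat_dvd_iff)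
  then obtain k where "nat m = 2 ^ k"
    using divides_primepow_nat[of 2 "nat m" e] by auto
  then have "m = 2 ^ k"
    using assms(1) by (metis int_nat_eq less_imp_le of_nat_numeral of_nat_power)
  then show ?thesis by (rule that)
qed

lemma odd_dvd_double_imp_dvd:
  fixes m b :: int
  assumes "odd m" "m dvd 2 * b"
  shows "m dvd b"
proof -
  have "coprime m 2"
    using assms(1) by simp
  then show ?thesis
    using assms(2) by (simp add: coprime_dvd_mult_right_iff)
qed

lemma three_power_mod_8: "(3::int) ^ w mod 8 = (if even w then 1 else 3)"
proof (induction w)
  case (Suc w)
  have "(3::int) ^ Suc w mod 8 = 3 * (3 ^ w mod 8) mod 8"
    by (simp add: mod_mult_right_eq)
  then show ?case
    using Suc by simp
qed simp

section \<open>The congruence\<close>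

theorem corollary1:
  fixes n :: nat
  assumes "n \<ge> 4"
  shows "\<not> (\<exists>x y z w :: nat. x > 0 \<and> y > 0 \<and> z > 0 \<and> w > 0 \<and>
           [n ^ x = (n + 1) ^ y + (n + 2) ^ z + (n + 3) ^ w] (mod (12 * (n + 1) * (n + 2))))"
proof
  assume "\<exists>x y z w :: nat. x > 0 \<and> y > 0 \<and> z > 0 \<and> w > 0 \<and>
           [n ^ x = (n + 1) ^ y + (n + 2) ^ z + (n + 3) ^ w] (mod (12 * (n + 1) * (n + 2)))"
  then obtain x y z w :: nat where pos: "x > 0" "y > 0" "z > 0" "w > 0"
    and eq: "[n ^ x = (n + 1) ^ y + (n + 2) ^ z + (n + 3) ^ w] (mod (12 * (n + 1) * (n + 2)))"
    by blast
  define N where "N = int n"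
  have N: "N \<ge> 4"
    using assms by (simp add: N_def)
  have eqN: "[N ^ x = (N + 1) ^ y + (N + 2) ^ z + (N + 3) ^ w] (mod (12 * (N + 1) * (N + 2)))"
    using eq unfolding cong_int_iff[symmetric]
    by (simp only: N_def of_nat_mult of_nat_add of_nat_power of_nat_numeral of_nat_1)
  \<comment> \<open>The form in which the congruence is reduced to each of the moduli below.\<close>
  have reduce: "[a ^ x = b ^ y + c ^ z + d ^ w] (mod m)"
    if "m dvd 12 * (N + 1) * (N + 2)" "[N = a] (mod m)" "[N + 1 = b] (mod m)"
      "[N + 2 = c] (mod m)" "[N + 3 = d] (mod m)" for a b c d m
  proof -
    have "[N ^ x = (N + 1) ^ y + (N + 2) ^ z + (N + 3) ^ w] (mod m)"
      using eqN that(1) by (rule cong_dvd_modulus)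
    moreover have "[N ^ x = a ^ x] (mod m)"
      "[(N + 1) ^ y + (N + 2) ^ z + (N + 3) ^ w = b ^ y + c ^ z + d ^ w] (mod m)"
      using that by (auto intro!: cong_add cong_pow)
    ultimately show ?thesis
      by (meson cong_sym cong_trans)
  qed
  have dvd_modulus: "N + 1 dvd 12 * (N + 1) * (N + 2)" "N + 2 dvd 12 * (N + 1) * (N + 2)"
    by (rule dvd_mult2[OF dvd_triv_right], rule dvd_triv_right)
  have "[(- 1) ^ x = 0 ^ y + 1 ^ z + 2 ^ w] (mod (N + 1))"
    by (rule reduce[OF dvd_modulus(1)]) (simp_all add: cong_iff_dvd_diff add.commute)
  then have mod1: "[(- 1) ^ x = 1 + 2 ^ w] (mod (N + 1))"
    using pos by (simp add: zero_power)
  have "[(- 2) ^ x = (- 1) ^ y + 0 ^ z + 1 ^ w] (mod (N + 2))"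
    by (rule reduce[OF dvd_modulus(2)]) (simp_all add: cong_iff_dvd_diff add.commute)
  then have mod2: "[(- 2) ^ x = (- 1) ^ y + 1] (mod (N + 2))"
    using pos by (simp add: zero_power)
  have Suc_x: "(2::int) ^ x = 2 * 2 ^ (x - 1)" and Suc_w: "(2::int) ^ w = 2 * 2 ^ (w - 1)"
    using pos by (simp_all flip: power_Suc)
  show False
  proof (cases "even x")
    case True
    then have "N + 1 dvd 2 ^ w"
      using mod1 by (simp add: cong_iff_dvd_diff)
    then obtain k where k: "N + 1 = 2 ^ k"
      using N by (auto elim: int_dvd_two_power_imp_power[rotated])
    have "k \<noteq> 0"
      using k N by (intro notI) simp
    have N2: "N + 2 = 2 ^ k + 1"
      using k by simp
    have "odd (N + 2)"
      unfolding N2 using \<open>k \<noteq> 0\<close> by simp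
    have "even y"
    proof (rule ccontr)
      assume "odd y"
      then have "N + 2 dvd 2 ^ x"
        using mod2 True by (simp add: cong_iff_dvd_diff)
      then obtain j where j: "N + 2 = 2 ^ j"
        using N by (auto elim: int_dvd_two_power_imp_power[rotated])
      then have "j \<noteq> 0"
        using N by (intro notI) simp
      then show False
        using j \<open>odd (N + 2)\<close> by simp
    qed
    then have "N + 2 dvd 2 * (2 ^ (x - 1) - 1)"
      using mod2 True Suc_x by (simp add: cong_iff_dvd_diff)
    then have "N + 2 dvd 2 ^ (x - 1) - 1"
      using \<open>odd (N + 2)\<close> by (rule odd_dvd_double_imp_dvd[rotated])
    then have "even (x - 1)"
      using N2 \<open>k \<noteq> 0\<close> two_power_cong_1_mod_Fermat_like_imp_even[of k "x - 1"]
      by (simp add: cong_iff_dvd_diff)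
    then show False
      using True pos by simp
  next
    case odd_x: False
    have "N + 1 dvd - (2 * (2 ^ (w - 1) + 1))"
      using mod1 odd_x Suc_w by (simp add: cong_iff_dvd_diff algebra_simps)
    then have w_dvd: "N + 1 dvd 2 * (2 ^ (w - 1) + 1)"
      by (simp only: dvd_minus_iff)
    show False
    proof (cases "even y")
      case False
      then have "N + 2 dvd 2 ^ x"
        using mod2 odd_x by (simp add: cong_iff_dvd_diff)
      then obtain k where k: "N + 2 = 2 ^ k"
        using N by (auto elim: int_dvd_two_power_imp_power[rotated])
      have "k \<ge> 3"
      proof (rule ccontr)
        assume "\<not> k \<ge> 3"
        then have "(2::int) ^ k \<le> 2 ^ 2"
          by (intro power_increasing) auto
        then show False using k N by simp
      qed
      have N1: "N + 1 = 2 ^ k - 1"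
        using k by simp
      have "odd (N + 1)"
        unfolding N1 using \<open>k \<ge> 3\<close> by simp
      then have "N + 1 dvd 2 ^ (w - 1) + 1"
        using w_dvd by (rule odd_dvd_double_imp_dvd)
      then show False
        using N1 Mersenne_not_dvd_two_power_plus_1[OF \<open>k \<ge> 3\<close>] by simp
    next
      case True
      define a :: int where "a = 2 ^ ((x - 1) div 2)"
      have "(x - 1) div 2 * 2 = x - 1"
        using odd_x by simp
      then have a: "2 ^ (x - 1) = a ^ 2"
        by (simp add: a_def flip: power_mult)
      have "N + 2 dvd - (2 * a ^ 2) - 2"
        using mod2 odd_x True Suc_x a by (simp add: cong_iff_dvd_diff)
      also have "- (2 * a ^ 2) - 2 = - (2 * (a ^ 2 + 1))"
        by simp
      finally have "N + 2 dvd - (2 * (a ^ 2 + 1))" .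
      then have x_dvd: "N + 2 dvd 2 * (a ^ 2 + 1)"
        by (simp only: dvd_minus_iff)
      \<comment> \<open>Exponents larger than \<open>1\<close> make \<open>a\<close> and \<open>2 ^ (w - 1)\<close> even, which
        limits the powers of \<open>2\<close> in \<open>N + 2\<close> and \<open>N + 1\<close>.\<close>
      have "x \<noteq> 1"
      proof
        assume "x = 1"
        then have "N + 2 dvd 4"
          using x_dvd a by simp
        then show False
          using N by (auto dest: zdvd_imp_le)
      qed
      have "w \<noteq> 1"
      proof
        assume "w = 1"
        then have "N + 1 dvd 4"
          using w_dvd by simp
        then show False
          using N by (auto dest: zdvd_imp_le)
      qed
      have "even a"
        using odd_x \<open>x \<noteq> 1\<close> by (auto simp: a_def elim!: oddE)
      have "odd ((2::int) ^ (w - 1) + 1)"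
        using \<open>w \<noteq> 1\<close> pos by simp
      have N4: "N mod 4 \<noteq> 3"
      proof
        assume "N mod 4 = 3"
        then have "4 dvd N + 1"
          by presburger
        then have "2 * 2 dvd 2 * ((2::int) ^ (w - 1) + 1)"
          using w_dvd dvd_trans by fastforce
        then show False
          using \<open>odd (2 ^ (w - 1) + 1)\<close> by (simp only: dvd_mult_cancel_left) simp
      qed
      have N8: "N mod 8 = 0"
      proof (cases "even N")
        case False
        then have "N + 2 dvd a ^ 2 + 1"
          using False by (auto intro: odd_dvd_double_imp_dvd[OF _ x_dvd])
        then have "(N + 2) mod 4 = 1"
          using False N by (intro odd_dvd_square_plus_1_imp_mod_4_eq_1[of "N + 2" a]) auto
        then show ?thesis
          using N4 by presburger
      next
        case True
        \<comment> \<open>As \<open>a\<close> is even, \<open>2\<close> divides \<open>2 (a^2 + 1)\<close> only once, and hence \<open>N + 2\<close> only once.\<close>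
        then have "even (N + 2)"
          by simp
        then obtain t where t: "N + 2 = 2 * t" ..
        have t_dvd: "t dvd a ^ 2 + 1"
          using x_dvd unfolding t by (simp only: dvd_mult_cancel_left) simp
        moreover have "odd (a ^ 2 + 1)"
          using \<open>even a\<close> by simp
        ultimately have "odd t"
          using dvd_trans by blast
        then have "t mod 4 = 1"
          using t t_dvd N by (intro odd_dvd_square_plus_1_imp_mod_4_eq_1[of t a]) auto
        then show ?thesis
          using t by presburger
      qed
      have N3: "N mod 3 \<noteq> 1"
      proof
        assume "N mod 3 = 1"
        then have "3 dvd N + 2"
          by presburger
        then have "3 dvd 2 * (a ^ 2 + 1)"
          using x_dvd dvd_trans by blast
        then have "3 dvd a ^ 2 + 1"
          by presburger
        then have "3 mod 4 = (1::int)"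
          by (intro odd_dvd_square_plus_1_imp_mod_4_eq_1[of 3 a]) auto
        then show False
          by simp
      qed
      have eq8: "[0 ^ x = 1 ^ y + 2 ^ z + 3 ^ w] (mod (8::int))"
      proof (rule reduce)
        obtain j where "N = 8 * j"
          using N8 by (auto simp: mod_eq_0_iff_dvd elim: dvdE)
        then have "12 * (N + 1) * (N + 2) = 8 * (3 * (8 * j + 1) * (4 * j + 1))"
          by (simp add: algebra_simps)
        then show "8 dvd 12 * (N + 1) * (N + 2)"
          by (rule dvdI)
      qed (use N8 in \<open>simp_all add: cong_iff_dvd_diff mod_eq_0_iff_dvd\<close>)
      have "z = 2 \<and> odd w"
      proof -
        define u :: int where "u = 3 ^ w"
        have u: "even w \<and> u mod 8 = 1 \<or> odd w \<and> u mod 8 = 3"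
          by (simp add: u_def three_power_mod_8)
        have sum8: "(1 + 2 ^ z + u) mod 8 = 0"
          using eq8 pos by (simp add: u_def cong_def zero_power)
        consider "z = 1" | "z = 2" | "z \<ge> 3"
          using pos by linarith
        then show ?thesis
        proof cases
          case 1
          then have "(3 + u) mod 8 = 0"
            using sum8 by simp
          then show ?thesis
            using u by presburger
        next
          case 2
          then have "(5 + u) mod 8 = 0"
            using sum8 by simp
          then show ?thesis
            using u 2 by presburger
        next
          case 3
          then have "8 dvd (2::int) ^ z"
            using le_imp_power_dvd[of 3 z "2::int"] by simp
          then obtain v :: int where "2 ^ z = 8 * v" ..
          then have "(1 + 8 * v + u) mod 8 = 0"
            using sum8 by simp
          then show ?thesis
            using u by presburger
        qed
      qed
      moreover have "odd z \<or> even w"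
      proof -
        have three: "3 dvd 12 * (N + 1) * (N + 2)"
          by (intro dvd_mult2) simp
        have "N mod 3 = 0 \<or> N mod 3 = 2"
          using N3 by presburger
        then consider "N mod 3 = 0" | "N mod 3 = 2"
          by blast
        then show ?thesis
        proof cases
          case 1
          then have "[0 ^ x = 1 ^ y + (- 1) ^ z + 0 ^ w] (mod (3::int))"
            by (intro reduce[OF three]; unfold cong_iff_dvd_diff; presburger)
          then show ?thesis
            using pos by (cases "even z") (auto simp: cong_def zero_power)
        next
          case 2
          then have "[(- 1) ^ x = 0 ^ y + 1 ^ z + (- 1) ^ w] (mod (3::int))"
            by (intro reduce[OF three]; unfold cong_iff_dvd_diff; presburger)
          then show ?thesis
            using pos odd_x by (cases "even w") (auto simp: cong_def zero_power)
        qed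
      qed
      ultimately show False
        by auto
    qed
  qed
qed

end
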